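(* Let $l>0$ and $\rho^2-\rho^1>0$ (the Rayleigh–Taylor stable case). Let $f(t)\in H^3_l(\mathbb R)$ be the unique classical solution of the confined Muskat equation $$\partial_t f(x,t)=\frac{\rho^2-\rho^1}{8l}\,\mathrm{P.V.}\int_{\mathbb R}\Big[\big(\partial_xf(x)-\partial_xf(x-\eta)\big)\Xi_1(x,\eta)+\big(\partial_xf(x)+\partial_xf(x-\eta)\big)\Xi_2(x,\eta)\Big]d\eta$$ with initial datum $f(x,0)=f_0(x)$. Then, for all times $t\geq 0$ at which the solution exists, $$\|f(t)\|_{L^\infty}\le\|f_0\|_{L^\infty}.$$
   Context: The strip is $\mathbb R\times(-l,l)$, $l>0$; $\rho^1,\rho^2$ are the constant densities of the upper and lower fluid, and the interface is the graph of $f(\cdot,t)$. Function space: $H^s_l(\mathbb R)=H^s(\mathbb R)\cap\{f:\|f\|_{L^\infty}<l\}$. Kernels (with time dependence suppressed): $$\Xi_1(x,\eta)=\frac{\sinh\left(\frac{\pi}{2l}\eta\right)}{\cosh\left(\frac{\pi}{2l}\eta\right)-\cos\left(\frac{\pi}{2l}(f(x)-f(x-\eta))\right)},\qquad \Xi_2(x,\eta)=\frac{\sinh\left(\frac{\pi}{2l}\eta\right)}{\cosh\left(\frac{\pi}{2l}\eta\right)+\cos\left(\frac{\pi}{2l}(f(x)+f(x-\eta))\right)}.$$ P.V. denotes principal value (at $\eta=0$ and at infinity). For $\rho^2-\rho^1>0$ and $f_0\in H^3_l(\mathbb R)$ the classical solution is the unique solution $f\in C([0,T],H^3_l(\mathbb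 R))\cap C^1([0,T],C(\mathbb R))\cap C([0,T],C^2(\mathbb R))$, which exists on some time interval $[0,T]$, $T>0$. *)

theory Defs
  imports "HOL-Analysis.Analysis" "HOL-Probability.Essential_Supremum"
begin

definition Linf_norm :: "(real \<Rightarrow> real) \<Rightarrow> ereal" where
  "Linf_norm u = esssup lborel (\<lambda>x. ereal \<bar>u x\<bar>)"

definition L2 :: "(real \<Rightarrow> real) set" where
  "L2 = {u. u \<in> borel_measurable lborel \<and> integrable lborel (\<lambda>x. (u x)\<^sup>2)}"

definition test_function :: "(real \<Rightarrow> real) \<Rightarrow> bool" where
  "test_function \<phi> \<longleftrightarrow>
     (\<forall>n x. (deriv ^^ n) \<phi> field_differentiable at x) \<and> compact (closure {x. \<phi> x \<noteq> 0})"

definition has_weak_deriv :: "nat \<Rightarrow> (real \<Rightarrow> real) \<Rightarrow> (real \<Rightarrow> real) \<Rightarrow> bool" where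
  "has_weak_deriv k u g \<longleftrightarrow>
     (\<forall>\<phi>. test_function \<phi> \<longrightarrow>
        (LINT x|lborel. u x * (deriv ^^ k) \<phi> x) = (- 1) ^ k * (LINT x|lborel. g x * \<phi> x))"

definition Sobolev :: "nat \<Rightarrow> (real \<Rightarrow> real) set" where
  "Sobolev s = {u \<in> L2. \<forall>k\<le>s. \<exists>g\<in>L2. has_weak_deriv k u g}"

text \<open>Weak derivatives in \<open>L2\<close> are unique up to null sets, so the norm below does not depend on the
  representative that is chosen.\<close>

definition weak_deriv :: "nat \<Rightarrow> (real \<Rightarrow> real) \<Rightarrow> real \<Rightarrow> real" where
  "weak_deriv k u = (SOME g. g \<in> L2 \<and> has_weak_deriv k u g)"

definition Sobolev_norm :: "nat \<Rightarrow> (real \<Rightarrow> real) \<Rightarrow> real" where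
  "Sobolev_norm s u = sqrt (\<Sum>k\<le>s. LINT x|lborel. (weak_deriv k u x)\<^sup>2)"

definition Sobolev_strip :: "nat \<Rightarrow> real \<Rightarrow> (real \<Rightarrow> real) set" where
  "Sobolev_strip s l = {u \<in> Sobolev s. Linf_norm u < ereal l}"

definition continuous_in_Sobolev_strip ::
    "nat \<Rightarrow> real \<Rightarrow> real \<Rightarrow> (real \<Rightarrow> real \<Rightarrow> real) \<Rightarrow> bool" where
  "continuous_in_Sobolev_strip s l T f \<longleftrightarrow>
     (\<forall>t\<in>{0..T}. f t \<in> Sobolev_strip s l \<and>
        ((\<lambda>\<tau>. Sobolev_norm s (\<lambda>x. f \<tau> x - f t x)) \<longlongrightarrow> 0) (at t within {0..T}))"

text \<open>The spaces \<open>C\<close> and \<open>C\<^sup>k\<close> on the line carry their usual supremum norms, so their elements are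
  bounded together with the derivatives involved. The arguments of a curve are time first, then
  space.\<close>

definition C_bounded :: "nat \<Rightarrow> (real \<Rightarrow> real) set" where
  "C_bounded k =
     {u. (\<forall>j\<le>k. (deriv ^^ j) u \<in> bcontfun) \<and>
         (\<forall>j<k. \<forall>x. (deriv ^^ j) u field_differentiable at x)}"

definition continuous_in_C :: "nat \<Rightarrow> real \<Rightarrow> (real \<Rightarrow> real \<Rightarrow> real) \<Rightarrow> bool" where
  "continuous_in_C k T f \<longleftrightarrow>
     (\<forall>t\<in>{0..T}. f t \<in> C_bounded k) \<and>
     (\<forall>j\<le>k. continuous_on {0..T} (\<lambda>t. Bcontfun ((deriv ^^ j) (f t))))"

definition C1_in_C :: "real \<Rightarrow> (real \<Rightarrow> real \<Rightarrow> real) \<Rightarrow> bool" where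
  "C1_in_C T f \<longleftrightarrow>
     (\<forall>t\<in>{0..T}. f t \<in> bcontfun) \<and>
     (\<exists>D :: real \<Rightarrow> (real, real) bcontfun.
        continuous_on {0..T} D \<and>
        (\<forall>t\<in>{0..T}. ((\<lambda>\<tau>. Bcontfun (f \<tau>)) has_vector_derivative D t) (at t within {0..T})))"

definition has_pv_integral :: "(real \<Rightarrow> real) \<Rightarrow> real \<Rightarrow> bool" where
  "has_pv_integral g I \<longleftrightarrow>
     (\<forall>\<epsilon> R. 0 < \<epsilon> \<longrightarrow> set_integrable lborel {\<eta>. \<epsilon> < \<bar>\<eta>\<bar> \<and> \<bar>\<eta>\<bar> < R} g) \<and>
     ((\<lambda>(\<epsilon>, R). LINT \<eta>:{\<eta>. \<epsilon> < \<bar>\<eta>\<bar> \<and> \<bar>\<eta>\<bar> < R}|lborel. g \<eta>) \<longlongrightarrow> I)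
       (at_right 0 \<times>\<^sub>F at_top)"

definition Xi1 :: "real \<Rightarrow> (real \<Rightarrow> real) \<Rightarrow> real \<Rightarrow> real \<Rightarrow> real" where
  "Xi1 l u x \<eta> =
     sinh (pi / (2 * l) * \<eta>) /
     (cosh (pi / (2 * l) * \<eta>) - cos (pi / (2 * l) * (u x - u (x - \<eta>))))"

definition Xi2 :: "real \<Rightarrow> (real \<Rightarrow> real) \<Rightarrow> real \<Rightarrow> real \<Rightarrow> real" where
  "Xi2 l u x \<eta> =
     sinh (pi / (2 * l) * \<eta>) /
     (cosh (pi / (2 * l) * \<eta>) + cos (pi / (2 * l) * (u x + u (x - \<eta>))))"

definition muskat_integrand :: "real \<Rightarrow> (real \<Rightarrow> real) \<Rightarrow> real \<Rightarrow> real \<Rightarrow> real" where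
  "muskat_integrand l u x \<eta> =
     (deriv u x - deriv u (x - \<eta>)) * Xi1 l u x \<eta> +
     (deriv u x + deriv u (x - \<eta>)) * Xi2 l u x \<eta>"

definition muskat_equation ::
    "real \<Rightarrow> real \<Rightarrow> real \<Rightarrow> real \<Rightarrow> (real \<Rightarrow> real \<Rightarrow> real) \<Rightarrow> bool" where
  "muskat_equation l \<rho>1 \<rho>2 T f \<longleftrightarrow>
     (\<forall>t\<in>{0..T}. \<forall>x. \<exists>I.
        has_pv_integral (muskat_integrand l (f t) x) I \<and>
        ((\<lambda>\<tau>. f \<tau> x) has_real_derivative (\<rho>2 - \<rho>1) / (8 * l) * I) (at t within {0..T}))"

definition classical_solution ::
    "real \<Rightarrow> real \<Rightarrow> real \<Rightarrow> (real \<Rightarrow> real) \<Rightarrow> real \<Rightarrow> (real \<Rightarrow> real \<Rightarrow> real) \<Rightarrow> bool" where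
  "classical_solution l \<rho>1 \<rho>2 f0 T f \<longleftrightarrow>
     continuous_in_Sobolev_strip 3 l T f \<and> C1_in_C T f \<and> continuous_in_C 2 T f \<and>
     muskat_equation l \<rho>1 \<rho>2 T f \<and> (\<forall>x. f 0 x = f0 x)"

end

theory Submission
  imports Defs
begin

text \<open>
  The supremum norm of the solution can only grow if the value at a point where \<open>\<bar>f\<bar>\<close> is largest
  moves outwards, and the equation forbids this: at a maximum of a profile \<open>u\<close> the principal value
  is at most zero (\<open>muskat_pv_nonpos_at_maximum\<close>), and by oddness in \<open>u\<close> it is at least zero at a
  minimum.

  For the sign, let \<open>u\<close> have a maximum \<open>M\<close> at \<open>x\<close>, and put \<open>a = \<pi> / (2 l)\<close>, \<open>c = cosh (a \<eta>)\<close>,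
  \<open>S = sinh (a \<eta>)\<close>, \<open>m = sin (a M)\<close>, \<open>k = cos (a M)\<close> and \<open>s(\<eta>) = sin (a u(x - \<eta>))\<close>. Since
  \<open>u'(x) = 0\<close>, the integrand is \<open>-u'(x - \<eta>) (\<Xi>\<^sub>1 - \<Xi>\<^sub>2)\<close>, and putting the two kernels over a common
  denominator makes it
  \<open>J = (2/a) k S s' / ((s - c m)\<^sup>2 + S\<^sup>2 k\<^sup>2)\<close>.
  This is what the chain rule gives for the variable \<open>s\<close> alone in the angle
  \<open>A(s, \<eta>) = arctan ((s - c m) / (S k))\<close>, times \<open>2/a\<close>. The remaining part of the derivative of
  \<open>A(s(\<eta>), \<eta>)\<close>, the explicit dependence on \<open>\<eta>\<close>, has no sign; subtracting the same angle for the
  constant profile \<open>s = m\<close> repairs this. For \<open>\<Psi>(\<eta>) = (2/a) (A(s(\<eta>), \<eta>) - A(m, \<eta>))\<close> one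
  has \<open>J \<le> \<Psi>'\<close> away from \<open>0\<close> because \<open>s \<le> m\<close> (\<open>excess_nonneg\<close>). Moreover \<open>\<Psi> \<le> 0\<close> on the right and
  \<open>\<Psi> \<ge> 0\<close> on the left of \<open>0\<close>, so the integral over \<open>\<epsilon> < \<bar>\<eta>\<bar> < R\<close> is at most \<open>\<Psi>(-\<epsilon>) - \<Psi>(\<epsilon>)\<close>,
  whatever \<open>R\<close> is. This vanishes as \<open>\<epsilon> \<rightarrow> 0\<close>, because \<open>s - m\<close> is of smaller order than \<open>\<eta>\<close> at the
  critical point.

  Two analytic facts connect this with the norm. The largest value of \<open>\<bar>f(t)\<bar>\<close> is attained, since a
  square integrable Lipschitz function tends to \<open>0\<close> at infinity
  (\<open>square_integrable_Lipschitz_abs_attains_sup\<close>). And the norm \<open>N(t)\<close> need not be differentiable: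
  it is continuous and at each time it is touched from below by \<open>\<plusminus>f(\<cdot>, x)\<close>, where \<open>x\<close> is a point of
  largest modulus, whose time derivative is at most zero there; that already makes \<open>N\<close> stay below
  \<open>N(0)\<close> (\<open>nonincreasing_if_touched_from_below\<close>).
\<close>

section \<open>The kernels at a critical point\<close>

text \<open>With \<open>v = u(x - \<eta>)\<close>, the product of the denominators of \<open>\<Xi>\<^sub>1\<close> and \<open>\<Xi>\<^sub>2\<close> depends on \<open>v\<close> only through
  \<open>sin (a v)\<close>, while the numerator of the difference carries the factor \<open>cos (a v)\<close>. This is why
  \<open>sin (a v)\<close> is the right dependent variable; completing the square gives \<open>D\<close>.\<close>

lemma kernel_difference:
  fixes a M v h :: real
  assumes "h \<noteq> 0" "cos (a * M) > 0"
  defines "D \<equiv> (sin (a * v) - cosh h * sin (a * M))\<^sup>2 + (sinh h * cos (a * M))\<^sup>2"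
  shows "D > 0"
    and "sinh h / (cosh h - cos (a * (M - v))) - sinh h / (cosh h + cos (a * (M + v)))
         = 2 * cos (a * M) * sinh h * cos (a * v) / D"
proof -
  have c: "cosh h > 1"
    using cosh_real_ge_1[of h] cosh_real_one_iff[of h] assms(1) by linarith
  show D: "D > 0"
    using assms by (auto simp: D_def intro!: add_nonneg_pos)
  have p: "cosh h - cos (a * (M - v)) > 0"
    using c cos_le_one[of "a * (M - v)"] by linarith
  have q: "cosh h + cos (a * (M + v)) > 0"
    using c cos_ge_minus_one[of "a * (M + v)"] by linarith
  have 1: "cos (a * (M - v)) = cos (a * M) * cos (a * v) + sin (a * M) * sin (a * v)"
    by (simp add: right_diff_distrib cos_diff)
  have 2: "cos (a * (M + v)) = cos (a * M) * cos (a * v) - sin (a * M) * sin (a * v)"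
    by (simp add: distrib_left cos_add)
  have e: "(cosh h - cos (a * (M - v))) * (cosh h + cos (a * (M + v))) = D"
    unfolding 1 2 D_def power_mult_distrib
    using sin_cos_squared_add[of "a * M"] sin_cos_squared_add[of "a * v"] cosh_square_eq[of h]
    by algebra
  have "sinh h / (cosh h - cos (a * (M - v))) - sinh h / (cosh h + cos (a * (M + v)))
      = sinh h * (cos (a * (M + v)) + cos (a * (M - v)))
        / ((cosh h - cos (a * (M - v))) * (cosh h + cos (a * (M + v))))"
    using p q by (simp add: divide_simps) (simp add: algebra_simps)
  also have "\<dots> = 2 * cos (a * M) * sinh h * cos (a * v) / D"
    unfolding e by (simp add: 1 2)
  finally show "sinh h / (cosh h - cos (a * (M - v))) - sinh h / (cosh h + cos (a * (M + v)))
         = 2 * cos (a * M) * sinh h * cos (a * v) / D" .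
qed

text \<open>Up to a positive constant, each side is the explicit \<open>\<eta>\<close>-derivative of the angle
  \<open>arctan ((s - c m) / (S k))\<close>. After cross-multiplication the claim is a quadratic inequality in
  \<open>s\<close> with the root \<open>s = m\<close>; the cofactor is nonnegative since \<open>c (c + 1) \<ge> 2\<close> exceeds
  \<open>m\<^sup>2 + m s\<close>.\<close>

lemma excess_nonneg:
  fixes c s m :: real
  assumes "c > 1" "m\<^sup>2 < 1" "\<bar>s\<bar> \<le> 1" "s \<le> m"
  defines "D \<equiv> \<lambda>r. (r - c * m)\<^sup>2 + (c\<^sup>2 - 1) * (1 - m\<^sup>2)"
  shows "(m - m * c) / D m \<le> (m - s * c) / D s"
proof -
  have "c\<^sup>2 > 1" using assms(1) by (simp add: one_less_power)
  then have pos: "D r > 0" for r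
    unfolding D_def using assms(2) by (intro add_nonneg_pos) auto
  have "\<bar>m\<bar> \<le> 1" using assms(2) by (simp add: abs_square_le_1[symmetric] less_imp_le)
  then have "\<bar>m * s\<bar> \<le> 1 * 1" unfolding abs_mult using assms(3) by (intro mult_mono) auto
  moreover have "c * (c + 1) \<ge> 1 * 2" using assms(1) by (intro mult_mono) auto
  ultimately have "c * (c + 1) - m\<^sup>2 - m * s \<ge> 0" using assms(2) by linarith
  then have "(c - 1) * ((m - s) * (c * (c + 1) - m\<^sup>2 - m * s)) \<ge> 0"
    using assms(1,4) by auto
  also have "(c - 1) * ((m - s) * (c * (c + 1) - m\<^sup>2 - m * s))
      = (m - s * c) * D m - (m - m * c) * D s"
    unfolding D_def by (simp add: algebra_simps power2_eq_square)
  finally have "(m - m * c) * D s \<le> (m - s * c) * D m" by simp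
  then show ?thesis using pos[of m] pos[of s] by (simp add: divide_simps mult.commute)
qed

text \<open>The first summand comes from the motion of \<open>s\<close> and is, up to the factor \<open>2/a\<close>, the integrand of
  the equation; the second one is the explicit dependence on \<open>\<eta>\<close> that \<open>excess_nonneg\<close> compares
  between two profiles.\<close>

lemma angle_derivative:
  fixes s :: "real \<Rightarrow> real"
  assumes s: "(s has_real_derivative s') (at \<eta>)"
    and "a \<noteq> 0" "\<eta> \<noteq> 0" "k > 0" "k\<^sup>2 = 1 - m\<^sup>2"
  defines "D \<equiv> (s \<eta> - cosh (a * \<eta>) * m)\<^sup>2 + (sinh (a * \<eta>) * k)\<^sup>2"
  shows "((\<lambda>\<eta>. arctan ((s \<eta> - cosh (a * \<eta>) * m) / (sinh (a * \<eta>) * k))) has_real_derivative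
          k * sinh (a * \<eta>) * s' / D + a * k * ((m - s \<eta> * cosh (a * \<eta>)) / D)) (at \<eta>)"
proof -
  let ?c = "cosh (a * \<eta>)" and ?S = "sinh (a * \<eta>)"
  let ?n = "s \<eta> - ?c * m"
  have S: "?S * k \<noteq> 0" using assms by auto
  have D: "D > 0" unfolding D_def using S by (intro add_nonneg_pos) auto
  have cS: "?c\<^sup>2 = ?S\<^sup>2 + 1" by (rule cosh_square_eq)
  have 1: "1 + (?n / (?S * k))\<^sup>2 = D / (?S * k)\<^sup>2"
    unfolding D_def power_divide using S by (simp add: add_divide_distrib)
  have 2: "(s' - a * ?S * m) * (?S * k) - ?n * (a * ?c * k)
         = k * ?S * s' + a * k * (m - s \<eta> * ?c)"
    using cS by algebra
  have 3: "inverse (1 + (?n / (?S * k))\<^sup>2)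
        * (((s' - a * ?S * m) * (?S * k) - ?n * (a * ?c * k)) / ((?S * k) * (?S * k)))
        = k * ?S * s' / D + a * k * ((m - s \<eta> * ?c) / D)"
    unfolding 1 2 using S D by (simp add: field_simps power2_eq_square)
  show ?thesis
    unfolding 3[symmetric]
    by (rule derivative_eq_intros s refl | use S in simp)+
qed

section \<open>The sign of the principal value at an extremum\<close>

text \<open>The comparison is made between gauge integrals: for them the fundamental theorem of
  calculus covers every derivative, and a Lebesgue integrable \<open>J\<close> keeps its integral.\<close>

lemma lborel_integral_le_increment:
  fixes J \<Psi> \<Psi>' :: "real \<Rightarrow> real"
  assumes "\<alpha> \<le> \<beta>" and J: "set_integrable lborel {\<alpha><..<\<beta>} J"
    and d: "\<And>\<eta>. \<eta> \<in> {\<alpha>..\<beta>} \<Longrightarrow> (\<Psi> has_real_derivative \<Psi>' \<eta>) (at \<eta>)"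
    and le: "\<And>\<eta>. \<eta> \<in> {\<alpha>..\<beta>} \<Longrightarrow> J \<eta> \<le> \<Psi>' \<eta>"
  shows "(LINT \<eta>:{\<alpha><..<\<beta>}|lborel. J \<eta>) \<le> \<Psi> \<beta> - \<Psi> \<alpha>"
proof -
  have \<Psi>: "(\<Psi>' has_integral \<Psi> \<beta> - \<Psi> \<alpha>) {\<alpha>..\<beta>}"
    using assms(1) d
    by (intro fundamental_theorem_of_calculus)
       (auto simp: has_real_derivative_iff_has_vector_derivative[symmetric]
             intro: has_field_derivative_at_within)
  have "(J has_integral integral {\<alpha><..<\<beta>} J) {\<alpha>..\<beta>}"
    using set_borel_integral_eq_integral(1)[OF J]
    by (simp add: has_integral_Icc_iff_Ioo integrable_integral)
  from has_integral_le[OF this \<Psi> le] show ?thesis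
    unfolding set_borel_integral_eq_integral(2)[OF J] .
qed

text \<open>The signs of \<open>\<Psi>\<close> discard the two boundary terms at \<open>\<plusminus>R\<close>; the two at \<open>\<plusminus>\<epsilon>\<close> vanish in the limit.\<close>

lemma pv_integral_nonpos:
  fixes J \<Psi> \<Psi>' :: "real \<Rightarrow> real"
  assumes pv: "has_pv_integral J I"
    and d: "\<And>\<eta>. \<eta> \<noteq> 0 \<Longrightarrow> (\<Psi> has_real_derivative \<Psi>' \<eta>) (at \<eta>)"
    and le: "\<And>\<eta>. \<eta> \<noteq> 0 \<Longrightarrow> J \<eta> \<le> \<Psi>' \<eta>"
    and right: "\<And>\<eta>. \<eta> > 0 \<Longrightarrow> \<Psi> \<eta> \<le> 0" and left: "\<And>\<eta>. \<eta> < 0 \<Longrightarrow> \<Psi> \<eta> \<ge> 0"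
    and zero: "(\<Psi> \<longlongrightarrow> 0) (at 0)"
  shows "I \<le> 0"
proof -
  let ?F = "at_right (0::real) \<times>\<^sub>F (at_top :: real filter)"
  let ?A = "\<lambda>(\<epsilon>::real) R. {\<eta>. \<epsilon> < \<bar>\<eta>\<bar> \<and> \<bar>\<eta>\<bar> < R}"
  have le': "(LINT \<eta>:?A \<epsilon> R|lborel. J \<eta>) \<le> \<Psi> (- \<epsilon>) - \<Psi> \<epsilon>" if "0 < \<epsilon>" "\<epsilon> < R" for \<epsilon> R
  proof -
    have A: "?A \<epsilon> R = {-R<..<-\<epsilon>} \<union> {\<epsilon><..<R}" using that by auto
    have int: "set_integrable lborel (?A \<epsilon> R) J" using pv that unfolding has_pv_integral_def by auto
    have i1: "set_integrable lborel {-R<..<-\<epsilon>} J" and i2: "set_integrable lborel {\<epsilon><..<R} J"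
      by (rule set_integrable_subset[OF int]; use A in auto)+
    have "(LINT \<eta>:?A \<epsilon> R|lborel. J \<eta>)
        = (LINT \<eta>:{-R<..<-\<epsilon>}|lborel. J \<eta>) + (LINT \<eta>:{\<epsilon><..<R}|lborel. J \<eta>)"
      unfolding A using that i1 i2 by (intro set_integral_Un) auto
    also have "\<dots> \<le> (\<Psi> (- \<epsilon>) - \<Psi> (- R)) + (\<Psi> R - \<Psi> \<epsilon>)"
      using that by (intro add_mono lborel_integral_le_increment[where \<Psi>' = \<Psi>'] i1 i2 d le) auto
    finally show ?thesis using left[of "- R"] right[of R] that by linarith
  qed
  have fst: "filterlim fst (at_right 0) ?F" by (rule filterlim_fst)
  have "((\<lambda>\<epsilon>. \<Psi> (- \<epsilon>) - \<Psi> \<epsilon>) \<longlongrightarrow> 0 - 0) (at_right 0)"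
  proof (intro tendsto_diff)
    show "((\<lambda>\<epsilon>. \<Psi> (- \<epsilon>)) \<longlongrightarrow> 0) (at_right 0)"
      using zero[unfolded filterlim_at_split] by (simp add: filterlim_at_left_to_right)
    show "(\<Psi> \<longlongrightarrow> 0) (at_right 0)"
      using zero by (simp add: filterlim_at_split)
  qed
  then have lim: "((\<lambda>p. \<Psi> (- fst p) - \<Psi> (fst p)) \<longlongrightarrow> 0) ?F"
    using filterlim_compose[OF _ fst] by fastforce
  have ev: "\<forall>\<^sub>F p in ?F. 0 < fst p \<and> fst p < snd p"
  proof -
    have "\<forall>\<^sub>F p in ?F. fst p \<in> {0<..<1}"
      using fst eventually_at_right_real[of 0 1] by (auto simp: filterlim_iff)
    moreover have "\<forall>\<^sub>F p in ?F. snd p > 1"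
      by (rule filterlim_iff[THEN iffD1, rule_format, OF filterlim_snd eventually_gt_at_top])
    ultimately show ?thesis by eventually_elim auto
  qed
  show "I \<le> 0"
  proof (rule tendsto_le[OF _ lim])
    show "?F \<noteq> bot" by (simp add: prod_filter_eq_bot)
    show "((\<lambda>(\<epsilon>, R). LINT \<eta>:?A \<epsilon> R|lborel. J \<eta>) \<longlongrightarrow> I) ?F"
      using pv unfolding has_pv_integral_def by auto
    show "\<forall>\<^sub>F p in ?F. (case p of (\<epsilon>, R) \<Rightarrow> LINT \<eta>:?A \<epsilon> R|lborel. J \<eta>) \<le> \<Psi> (- fst p) - \<Psi> (fst p)"
      using ev by eventually_elim (auto intro: le')
  qed
qed

text \<open>Here \<open>\<Psi>\<close> is the angle of the actual profile minus the angle of the constant profile \<open>u(x)\<close>.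
  The strip condition keeps \<open>a u\<close> inside \<open>(-\<pi>/2, \<pi>/2)\<close>, where the sine is increasing and the cosine
  positive: hence \<open>s \<le> m\<close> and \<open>k > 0\<close>.\<close>

lemma muskat_pv_nonpos_at_maximum:
  assumes l: "l > 0" and diff: "\<And>y. u field_differentiable at y"
    and bound: "\<And>y. \<bar>u y\<bar> < l" and max: "\<And>y. u y \<le> u x"
    and pv: "has_pv_integral (muskat_integrand l u x) I"
  shows "I \<le> 0"
proof -
  define a where "a = pi / (2 * l)"
  have a: "a > 0" using l by (simp add: a_def)
  define m where "m = sin (a * u x)"
  define k where "k = cos (a * u x)"
  define s where "s \<eta> = sin (a * u (x - \<eta>))" for \<eta>
  define s' where "s' \<eta> = - (a * cos (a * u (x - \<eta>)) * deriv u (x - \<eta>))" for \<eta>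
  define D where "D r \<eta> = (r - cosh (a * \<eta>) * m)\<^sup>2 + (sinh (a * \<eta>) * k)\<^sup>2" for r \<eta>
  define A where "A r \<eta> = arctan ((r - cosh (a * \<eta>) * m) / (sinh (a * \<eta>) * k))" for r \<eta>
  define e where "e r \<eta> = (m - r * cosh (a * \<eta>)) / D r \<eta>" for r \<eta>
  have angle: "\<bar>a * u y\<bar> < pi / 2" for y
    using mult_strict_left_mono[OF bound[of y] a] a l by (simp add: abs_mult a_def)
  have k: "k > 0" unfolding k_def using angle[of x] by (intro cos_gt_zero_pi) auto
  have km: "k\<^sup>2 = 1 - m\<^sup>2" unfolding k_def m_def by (rule cos_squared_eq)
  have m1: "m\<^sup>2 < 1" using km k zero_less_power[OF k, of 2] by linarith
  have sm: "s \<eta> \<le> m" for \<eta>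
    unfolding s_def m_def using angle[of x] angle[of "x - \<eta>"] max[of "x - \<eta>"] a
    by (intro sin_monotone_2pi_le) auto
  have du: "(u has_real_derivative deriv u y) (at y)" for y
    using diff by (simp add: DERIV_deriv_iff_field_differentiable)
  have crit: "deriv u x = 0"
    using DERIV_local_max[OF du zero_less_one] max by blast
  have ds: "(s has_real_derivative s' \<eta>) (at \<eta>)" for \<eta>
    unfolding s_def s'_def
    by (rule derivative_eq_intros DERIV_chain2[OF du] refl)+ simp
  define \<Psi> where "\<Psi> \<eta> = 2 / a * (A (s \<eta>) \<eta> - A m \<eta>)" for \<eta>
  define J where "J \<eta> = 2 / a * (k * sinh (a * \<eta>) * s' \<eta> / D (s \<eta>) \<eta>)" for \<eta>
  define \<Psi>' where "\<Psi>' \<eta> = J \<eta> + 2 * k * (e (s \<eta>) \<eta> - e m \<eta>)" for \<eta>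
  have d: "(\<Psi> has_real_derivative \<Psi>' \<eta>) (at \<eta>)" if "\<eta> \<noteq> 0" for \<eta>
  proof -
    have 1: "((\<lambda>\<eta>. A (s \<eta>) \<eta>) has_real_derivative
        k * sinh (a * \<eta>) * s' \<eta> / D (s \<eta>) \<eta> + a * k * e (s \<eta>) \<eta>) (at \<eta>)"
      unfolding A_def D_def e_def using a that k km by (intro angle_derivative ds) auto
    have 2: "((\<lambda>\<eta>. A m \<eta>) has_real_derivative
        k * sinh (a * \<eta>) * 0 / D m \<eta> + a * k * e m \<eta>) (at \<eta>)"
      unfolding A_def D_def e_def using a that k km
      by (intro angle_derivative[where s = "\<lambda>_. m"]) auto
    show ?thesis
      unfolding \<Psi>_def \<Psi>'_def J_def
      by (rule derivative_eq_intros 1 2 refl)+ (use a in \<open>simp add: field_simps\<close>)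
  qed
  have J: "muskat_integrand l u x \<eta> = J \<eta>" if "\<eta> \<noteq> 0" for \<eta>
  proof -
    have 1: "Xi1 l u x \<eta> - Xi2 l u x \<eta>
        = 2 * k * sinh (a * \<eta>) * cos (a * u (x - \<eta>)) / D (s \<eta>) \<eta>"
      unfolding Xi1_def Xi2_def a_def[symmetric] k_def D_def s_def m_def
      using that a k by (intro kernel_difference(2)) (auto simp: k_def)
    have "muskat_integrand l u x \<eta> = - deriv u (x - \<eta>) * (Xi1 l u x \<eta> - Xi2 l u x \<eta>)"
      unfolding muskat_integrand_def crit by (simp add: algebra_simps)
    also have "\<dots> = J \<eta>" unfolding 1 J_def s'_def using a by (simp add: field_simps)
    finally show ?thesis .
  qed
  have le: "J \<eta> \<le> \<Psi>' \<eta>" if "\<eta> \<noteq> 0" for \<eta>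
  proof -
    have c: "cosh (a * \<eta>) > 1"
      using cosh_real_ge_1[of "a * \<eta>"] that a by (simp add: less_le)
    have Seq: "(sinh (a * \<eta>) * k)\<^sup>2 = ((cosh (a * \<eta>))\<^sup>2 - 1) * (1 - m\<^sup>2)"
      by (simp add: power_mult_distrib km cosh_square_eq)
    have "e m \<eta> \<le> e (s \<eta>) \<eta>"
      unfolding e_def D_def Seq
      by (rule excess_nonneg[OF c m1 _ sm]) (simp add: s_def)
    then show ?thesis unfolding \<Psi>'_def using k by simp
  qed
  have right: "\<Psi> \<eta> \<le> 0" if "\<eta> > 0" for \<eta>
  proof -
    have "sinh (a * \<eta>) * k > 0" using a k that by simp
    then have "A (s \<eta>) \<eta> \<le> A m \<eta>"
      unfolding A_def arctan_le_iff using sm[of \<eta>] by (intro divide_right_mono) auto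
    then show ?thesis unfolding \<Psi>_def using a by (simp add: divide_nonpos_pos)
  qed
  have left: "\<Psi> \<eta> \<ge> 0" if "\<eta> < 0" for \<eta>
  proof -
    have "sinh (a * \<eta>) * k < 0" using a k that by (simp add: mult_neg_pos mult_pos_neg)
    then have "A m \<eta> \<le> A (s \<eta>) \<eta>"
      unfolding A_def arctan_le_iff using sm[of \<eta>] by (intro divide_right_mono_neg) auto
    then show ?thesis unfolding \<Psi>_def using a by simp
  qed
  \<comment> \<open>The numerator of the angle vanishes to first order at \<open>0\<close>, the denominator does not; this applies
    both to the actual profile and to the constant one.\<close>
  have A0: "((\<lambda>\<eta>. A (r \<eta>) \<eta>) \<longlongrightarrow> 0) (at 0)"
    if r: "(r has_real_derivative 0) (at 0)" "r 0 = m" for r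
  proof -
    have "((\<lambda>\<eta>. r \<eta> - cosh (a * \<eta>) * m) has_real_derivative 0) (at 0)"
      by (rule derivative_eq_intros r refl)+ simp
    then have 1: "((\<lambda>\<eta>. (r \<eta> - cosh (a * \<eta>) * m) / \<eta>) \<longlongrightarrow> 0) (at 0)"
      using r(2) by (simp add: has_field_derivative_iff)
    have "((\<lambda>\<eta>. sinh (a * \<eta>) * k) has_real_derivative a * k) (at 0)"
      by (rule derivative_eq_intros refl)+ simp
    then have 2: "((\<lambda>\<eta>. sinh (a * \<eta>) * k / \<eta>) \<longlongrightarrow> a * k) (at 0)"
      by (simp add: has_field_derivative_iff)
    have "((\<lambda>\<eta>. ((r \<eta> - cosh (a * \<eta>) * m) / \<eta>) / (sinh (a * \<eta>) * k / \<eta>)) \<longlongrightarrow> 0 / (a * k)) (at 0)"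
      using a k by (intro tendsto_divide 1 2) auto
    then have "((\<lambda>\<eta>. (r \<eta> - cosh (a * \<eta>) * m) / (sinh (a * \<eta>) * k)) \<longlongrightarrow> 0) (at 0)"
      by (rule Lim_cong_within[THEN iffD1, rotated -1]) auto
    from tendsto_arctan[OF this] show ?thesis unfolding A_def by simp
  qed
  have zero: "(\<Psi> \<longlongrightarrow> 0) (at 0)"
  proof -
    have "s' 0 = 0" by (simp add: s'_def crit)
    then have s0: "(s has_real_derivative 0) (at 0)" using ds[of 0] by simp
    have "((\<lambda>\<eta>. 2 / a * (A (s \<eta>) \<eta> - A m \<eta>)) \<longlongrightarrow> 2 / a * (0 - 0)) (at 0)"
      by (intro tendsto_mult tendsto_diff tendsto_const A0 s0) (auto simp: s_def m_def)
    then show ?thesis by (simp add: \<Psi>_def[abs_def])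
  qed
  show "I \<le> 0"
    by (rule pv_integral_nonpos[OF pv d _ right left zero]) (simp_all add: J le)
qed

lemma muskat_integrand_uminus:
  assumes "\<And>y. u field_differentiable at y"
  shows "muskat_integrand l (\<lambda>y. - u y) x \<eta> = - muskat_integrand l u x \<eta>"
proof -
  have d: "deriv (\<lambda>y. - u y) y = - deriv u y" for y
    using assms by (intro DERIV_imp_deriv DERIV_minus) (simp add: DERIV_deriv_iff_field_differentiable)
  have 1: "cos (b * (- p - - q)) = cos (b * (p - q))" for b p q :: real
    by (metis cos_minus minus_diff_minus mult_minus_right)
  have 2: "cos (b * (- p + - q)) = cos (b * (p + q))" for b p q :: real
    by (metis cos_minus minus_add_distrib mult_minus_right)
  have "Xi1 l (\<lambda>y. - u y) x \<eta> = Xi1 l u x \<eta>" "Xi2 l (\<lambda>y. - u y) x \<eta> = Xi2 l u x \<eta>"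
    unfolding Xi1_def Xi2_def 1 2 by (rule refl)+
  then show ?thesis
    unfolding muskat_integrand_def d by (simp add: left_diff_distrib distrib_right)
qed

lemma has_pv_integral_uminus:
  assumes "has_pv_integral g I"
  shows "has_pv_integral (\<lambda>\<eta>. - g \<eta>) (- I)"
proof -
  have "((\<lambda>(\<epsilon>, R). - (LINT \<eta>:{\<eta>. \<epsilon> < \<bar>\<eta>\<bar> \<and> \<bar>\<eta>\<bar> < R}|lborel. g \<eta>)) \<longlongrightarrow> - I)
      (at_right 0 \<times>\<^sub>F at_top)"
    using assms unfolding has_pv_integral_def case_prod_beta by (intro tendsto_minus) auto
  with assms show ?thesis
    unfolding has_pv_integral_def set_lebesgue_integral_def set_integrable_def by simp
qed

lemma muskat_pv_nonneg_at_minimum: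
  assumes l: "l > 0" and diff: "\<And>y. u field_differentiable at y"
    and bound: "\<And>y. \<bar>u y\<bar> < l" and min: "\<And>y. u x \<le> u y"
    and pv: "has_pv_integral (muskat_integrand l u x) I"
  shows "I \<ge> 0"
proof -
  have "has_pv_integral (muskat_integrand l (\<lambda>y. - u y) x) (- I)"
    using has_pv_integral_uminus[OF pv] unfolding muskat_integrand_uminus[OF diff] .
  then have "- I \<le> 0"
    using bound min
    by (intro muskat_pv_nonpos_at_maximum[OF l]) (auto intro: field_differentiable_minus diff)
  then show ?thesis by simp
qed

section \<open>The supremum norm of a profile\<close>

text \<open>Far out, a point with \<open>\<bar>u\<bar> \<ge> c\<close> would be the left end of an interval of fixed length on which
  \<open>\<bar>u\<bar> \<ge> c/2\<close>, and the integral of \<open>u\<^sup>2\<close> over that interval would exceed the tail of the convergent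
  integral.\<close>

lemma square_integrable_Lipschitz_superlevel_bounded:
  assumes u: "integrable lborel (\<lambda>x. (u x)\<^sup>2)" and L: "L-lipschitz_on UNIV u" and c: "c > 0"
  shows "bounded {x::real. c \<le> \<bar>u x :: real\<bar>}"
proof -
  \<comment> \<open>\<open>L\<close> may be zero, hence the summand 1.\<close>
  define \<delta> where "\<delta> = c / (2 * (L + 1))"
  have L0: "L \<ge> 0" using L by (rule lipschitz_on_nonneg)
  have \<delta>: "\<delta> > 0" "L * \<delta> \<le> c / 2" using L0 c by (auto simp: \<delta>_def field_simps)
  define w where "w R x = indicator {y. R \<le> \<bar>y\<bar>} x * (u x)\<^sup>2" for R x :: real
  have meas: "w R \<in> borel_measurable lborel" for R
    unfolding w_def
    by (intro borel_measurable_times borel_measurable_integrable[OF u]) measurable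
  have "((\<lambda>R. LINT x|lborel. w R x) \<longlongrightarrow> (LINT x::real|lborel. (0::real))) at_top"
  proof (rule integral_dominated_convergence_at_top[where w = "\<lambda>x. (u x)\<^sup>2"])
    show "\<forall>\<^sub>F R in at_top. AE x in lborel. norm (w R x) \<le> (u x)\<^sup>2"
      by (intro always_eventually allI AE_I2) (auto simp: w_def indicator_def)
    show "AE x in lborel. ((\<lambda>R. w R x) \<longlongrightarrow> 0) at_top"
    proof (intro AE_I2 tendsto_eventually)
      show "\<forall>\<^sub>F R in at_top. w R x = 0" for x
        using eventually_gt_at_top[of "\<bar>x\<bar>"] by eventually_elim (auto simp: w_def)
    qed
  qed (use u meas in auto)
  then have "\<forall>\<^sub>F R in at_top. (LINT x|lborel. w R x) < (c / 2)\<^sup>2 * \<delta>"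
    using c \<delta> by (intro order_tendstoD) auto
  then obtain R where R: "(LINT x|lborel. w R x) < (c / 2)\<^sup>2 * \<delta>"
    using eventually_happens trivial_limit_at_top_linorder by blast
  have wi: "integrable lborel (w R)"
    by (rule Bochner_Integration.integrable_bound[OF u meas]) (auto simp: w_def indicator_def)
  have "\<bar>x\<bar> \<le> R + \<delta>" if x: "c \<le> \<bar>u x\<bar>" for x
  proof (rule ccontr)
    assume far: "\<not> \<bar>x\<bar> \<le> R + \<delta>"
    have ge: "indicator {x..x+\<delta>} y * (c / 2)\<^sup>2 \<le> w R y" for y
    proof (cases "y \<in> {x..x+\<delta>}")
      case True
      have "\<bar>u y - u x\<bar> \<le> L * \<bar>y - x\<bar>"
        using lipschitz_onD[OF L, of y x] by (simp add: dist_real_def)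
      also have "\<dots> \<le> L * \<delta>" using True L0 by (intro mult_left_mono) auto
      finally have "c / 2 \<le> \<bar>u y\<bar>" using x \<delta>(2) by linarith
      then have "(c / 2)\<^sup>2 \<le> (u y)\<^sup>2" using c abs_le_square_iff[of "c / 2" "u y"] by auto
      moreover have "R \<le> \<bar>y\<bar>" using far True by auto
      ultimately show ?thesis using True by (simp add: w_def)
    qed (auto simp: w_def)
    have "(c / 2)\<^sup>2 * \<delta> = (LINT y|lborel. indicator {x..x+\<delta>} y * (c / 2)\<^sup>2)"
      using \<delta> by simp
    also have "\<dots> \<le> (LINT y|lborel. w R y)"
      using \<delta> by (intro integral_mono wi ge) auto
    finally show False using R by simp
  qed
  then show ?thesis by (auto simp: bounded_iff)
qed

lemma square_integrable_Lipschitz_abs_attains_sup: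
  fixes u :: "real \<Rightarrow> real"
  assumes u: "integrable lborel (\<lambda>x. (u x)\<^sup>2)" and L: "L-lipschitz_on UNIV u"
  obtains x where "\<And>y. \<bar>u y\<bar> \<le> \<bar>u x\<bar>"
proof (cases "\<forall>z. u z = 0")
  case False
  then obtain z where z: "\<bar>u z\<bar> > 0" by auto
  let ?S = "{x. \<bar>u z\<bar> \<le> \<bar>u x\<bar>}"
  have cont: "continuous_on UNIV u" using L by (rule lipschitz_on_continuous_on)
  have "closed ?S"
    by (intro closed_Collect_le continuous_intros cont)
  then have "compact ?S"
    using square_integrable_Lipschitz_superlevel_bounded[OF u L z] by (simp add: compact_eq_bounded_closed)
  moreover have "continuous_on ?S (\<lambda>x. \<bar>u x\<bar>)"
    by (intro continuous_intros continuous_on_subset[OF cont]) auto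
  ultimately obtain x where "x \<in> ?S" "\<forall>y\<in>?S. \<bar>u y\<bar> \<le> \<bar>u x\<bar>"
    using continuous_attains_sup[of ?S "\<lambda>x. \<bar>u x\<bar>"] by blast
  then have "\<bar>u y\<bar> \<le> \<bar>u x\<bar>" for y by (cases "y \<in> ?S") auto
  then show ?thesis using that by blast
qed (use that in auto)

text \<open>For a continuous function, a bound almost everywhere holds on a closed set of full measure, which
  is everything.\<close>

lemma Linf_norm_le_iff:
  assumes "continuous_on UNIV u"
  shows "Linf_norm u \<le> C \<longleftrightarrow> (\<forall>x. ereal \<bar>u x\<bar> \<le> C)"
proof
  have meas: "(\<lambda>x. ereal \<bar>u x\<bar>) \<in> borel_measurable lborel"
    using borel_measurable_continuous_onI[OF assms] by measurable
  show "Linf_norm u \<le> C" if "\<forall>x. ereal \<bar>u x\<bar> \<le> C"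
    unfolding Linf_norm_def using that by (intro esssup_I meas) auto
  assume C: "Linf_norm u \<le> C"
  have "AE x in lborel. ereal \<bar>u x\<bar> \<le> C"
    using esssup_AE[of "\<lambda>x. ereal \<bar>u x\<bar>" lborel] C by (auto simp: Linf_norm_def elim!: eventually_mono)
  then have "AE x in lebesgue. x \<in> {x. ereal \<bar>u x\<bar> \<le> C}" by (simp add: AE_completion_iff)
  moreover have "closed {x. ereal \<bar>u x\<bar> \<le> C}"
    by (intro closed_Collect_le continuous_intros continuous_on_ereal assms)
  ultimately show "\<forall>x. ereal \<bar>u x\<bar> \<le> C" using mem_closed_if_AE_lebesgue by blast
qed

section \<open>The maximum principle in time\<close>

text \<open>If \<open>N(\<tau>) - \<delta> \<tau>\<close> had its maximum over \<open>[0, T]\<close> at some \<open>r > 0\<close>, every function touching \<open>N\<close>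
  from below at \<open>r\<close> would have left difference quotients at least \<open>\<delta>\<close> there. So the maximum is at
  \<open>0\<close>, and \<open>\<delta>\<close> is arbitrary.\<close>

lemma nonincreasing_if_touched_from_below:
  fixes N :: "real \<Rightarrow> real"
  assumes cont: "continuous_on {0..T} N"
    and touch: "\<And>t. t \<in> {0<..T} \<Longrightarrow> \<exists>\<phi> d. \<phi> t = N t \<and> (\<forall>\<tau>\<in>{0..T}. \<phi> \<tau> \<le> N \<tau>) \<and>
       (\<phi> has_real_derivative d) (at t within {0..T}) \<and> d \<le> 0"
    and t: "t \<in> {0..T}"
  shows "N t \<le> N 0"
proof (rule field_le_epsilon)
  fix e :: real assume e: "e > 0"
  define \<delta> where "\<delta> = e / (t + 1)"
  have \<delta>: "\<delta> > 0" "\<delta> * t \<le> e" using e t by (auto simp: \<delta>_def field_simps)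
  define h where "h \<tau> = N \<tau> - \<delta> * \<tau>" for \<tau>
  have "continuous_on {0..T} h" unfolding h_def by (intro continuous_intros cont)
  then obtain r where r: "r \<in> {0..T}" and rmax: "\<And>\<tau>. \<tau> \<in> {0..T} \<Longrightarrow> h \<tau> \<le> h r"
    using continuous_attains_sup[of "{0..T}" h] t by auto
  have "r = 0"
  proof (rule ccontr)
    assume "r \<noteq> 0"
    then have "r > 0" using r by auto
    with r obtain \<phi> d where \<phi>: "\<phi> r = N r" "\<And>\<tau>. \<tau> \<in> {0..T} \<Longrightarrow> \<phi> \<tau> \<le> N \<tau>"
      "(\<phi> has_real_derivative d) (at r within {0..T})" "d \<le> 0"
      using touch[of r] by auto
    \<comment> \<open>For \<open>\<tau> < r\<close> the denominator \<open>\<tau> - r\<close> is negative, which turns the upper bound on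
      \<open>\<phi> \<tau>\<close> into a lower bound on the quotient.\<close>
    have "(\<phi> has_real_derivative d) (at r within {0..r})"
      by (rule has_field_derivative_subset[OF \<phi>(3)]) (use r in auto)
    then have "((\<lambda>\<tau>. (\<phi> \<tau> - \<phi> r) / (\<tau> - r)) \<longlongrightarrow> d) (at r within {0..r})"
      by (simp add: has_field_derivative_iff)
    moreover have "\<forall>\<^sub>F \<tau> in at r within {0..r}. \<delta> \<le> (\<phi> \<tau> - \<phi> r) / (\<tau> - r)"
      unfolding eventually_at_filter
    proof (intro always_eventually allI impI)
      fix \<tau> assume \<tau>: "\<tau> \<noteq> r" "\<tau> \<in> {0..r}"
      then have "\<phi> \<tau> - \<phi> r \<le> \<delta> * (\<tau> - r)"
        using \<phi>(2)[of \<tau>] rmax[of \<tau>] r \<phi>(1) by (auto simp: h_def algebra_simps)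
      then show "\<delta> \<le> (\<phi> \<tau> - \<phi> r) / (\<tau> - r)" using \<tau> by (simp add: neg_le_divide_eq)
    qed
    moreover have "at r within {0..r} \<noteq> bot" using \<open>r > 0\<close> by (simp add: trivial_limit_within islimpt_Icc)
    ultimately have "\<delta> \<le> d" by (rule tendsto_lowerbound)
    then show False using \<phi>(4) \<delta>(1) by simp
  qed
  then show "N t \<le> N 0 + e" using rmax[OF t] \<delta>(2) by (simp add: h_def)
qed

theorem theorem5:
  fixes l \<rho>1 \<rho>2 T :: real
    and f0 :: "real \<Rightarrow> real"
    and f :: "real \<Rightarrow> real \<Rightarrow> real"
  assumes "l > 0"
    and "\<rho>2 - \<rho>1 > 0"
    and "f0 \<in> Sobolev_strip 3 l"
    and "T > 0"
    and "classical_solution l \<rho>1 \<rho>2 f0 T f"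
  shows "\<forall>t\<in>{0..T}. Linf_norm (f t) \<le> Linf_norm f0"
proof
  have strip: "f t \<in> Sobolev_strip 3 l" and C2: "f t \<in> C_bounded 2" if "t \<in> {0..T}" for t
    using assms(5) that
    by (auto simp: classical_solution_def continuous_in_Sobolev_strip_def continuous_in_C_def)
  have init: "f 0 = f0" using assms(5) by (auto simp: classical_solution_def)
  have eq: "muskat_equation l \<rho>1 \<rho>2 T f" using assms(5) by (simp add: classical_solution_def)
  define N where "N t = norm (Bcontfun (f t))" for t
  have bcont: "f t \<in> bcontfun" if "t \<in> {0..T}" for t
    using C2[OF that] by (force simp: C_bounded_def dest: spec[of _ 0])
  have cont: "continuous_on UNIV (f t)" if "t \<in> {0..T}" for t
    using bcont[OF that] by (simp add: bcontfun_def)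
  have leN: "\<bar>f t x\<bar> \<le> N t" if "t \<in> {0..T}" for t x
    using norm_bounded[of "Bcontfun (f t)" x] bcont[OF that] by (simp add: N_def Bcontfun_inverse)
  have Nle: "N t \<le> C" if "t \<in> {0..T}" "\<And>x. \<bar>f t x\<bar> \<le> C" for t C
    unfolding N_def using bcont[OF that(1)] that(2) by (intro norm_bound) (simp add: Bcontfun_inverse)
  have contN: "continuous_on {0..T} N"
  proof -
    have "continuous_on {0..T} (\<lambda>t. Bcontfun ((deriv ^^ 0) (f t)))"
      using assms(5) unfolding classical_solution_def continuous_in_C_def by blast
    then show ?thesis unfolding N_def by (auto intro: continuous_on_norm)
  qed
  \<comment> \<open>The touching function follows \<open>\<plusminus>f\<close> at a point of largest modulus, with the sign that makes the
    value at time \<open>t\<close> nonnegative.\<close>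
  have touch: "\<exists>\<phi> d. \<phi> t = N t \<and> (\<forall>\<tau>\<in>{0..T}. \<phi> \<tau> \<le> N \<tau>) \<and>
       (\<phi> has_real_derivative d) (at t within {0..T}) \<and> d \<le> 0" if "t \<in> {0<..T}" for t
  proof -
    have t: "t \<in> {0..T}" using that by auto
    let ?u = "f t"
    have diff: "?u field_differentiable at y" for y
      using C2[OF t] by (force simp: C_bounded_def dest: spec[of _ 0])
    have "(deriv ^^ 1) ?u \<in> bcontfun" using C2[OF t] by (auto simp: C_bounded_def simp del: funpow.simps)
    then have "bounded (range (deriv ?u))" by (simp add: bcontfun_def)
    then obtain L where L: "\<And>y. \<bar>deriv ?u y\<bar> \<le> L" by (auto simp: bounded_iff)
    have lip: "L-lipschitz_on UNIV ?u"
    proof (rule lipschitz_onI)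
      show "0 \<le> L" using L[of 0] by linarith
      show "dist (?u y) (?u z) \<le> L * dist y z" for y z
        using field_differentiable_bound[of UNIV ?u "deriv ?u" L y z] L diff
        by (auto simp: dist_norm DERIV_deriv_iff_field_differentiable)
    qed
    have "integrable lborel (\<lambda>x. (?u x)\<^sup>2)"
      using strip[OF t] by (simp add: Sobolev_strip_def Sobolev_def L2_def)
    then obtain x where x: "\<And>y. \<bar>?u y\<bar> \<le> \<bar>?u x\<bar>"
      using square_integrable_Lipschitz_abs_attains_sup[OF _ lip] by blast
    have Nx: "N t = \<bar>?u x\<bar>" using leN[OF t, of x] Nle[OF t x] by linarith
    have bound: "\<bar>?u y\<bar> < l" for y
    proof -
      have "ereal \<bar>?u y\<bar> \<le> Linf_norm ?u" using Linf_norm_le_iff[OF cont[OF t]] by blast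
      also have "\<dots> < ereal l" using strip[OF t] by (simp add: Sobolev_strip_def)
      finally show ?thesis by simp
    qed
    obtain I where I: "has_pv_integral (muskat_integrand l ?u x) I"
      "((\<lambda>\<tau>. f \<tau> x) has_real_derivative (\<rho>2 - \<rho>1) / (8 * l) * I) (at t within {0..T})"
      using eq t unfolding muskat_equation_def by blast
    have pos: "(\<rho>2 - \<rho>1) / (8 * l) > 0" using assms(1,2) by simp
    show ?thesis
    proof (cases "?u x \<ge> 0")
      case True
      then have "?u y \<le> ?u x" for y using x[of y] by linarith
      then have "I \<le> 0"
        using muskat_pv_nonpos_at_maximum[OF assms(1) diff bound _ I(1)] by blast
      then have "(\<rho>2 - \<rho>1) / (8 * l) * I \<le> 0" using pos by (intro mult_nonneg_nonpos) auto
      moreover have "f \<tau> x \<le> N \<tau>" if "\<tau> \<in> {0..T}" for \<tau> using leN[OF that, of x] by linarith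
      ultimately show ?thesis using True Nx I(2) by (intro exI[of _ "\<lambda>\<tau>. f \<tau> x"]) auto
    next
      case False
      then have "?u x \<le> ?u y" for y using x[of y] by linarith
      then have "I \<ge> 0"
        using muskat_pv_nonneg_at_minimum[OF assms(1) diff bound _ I(1)] by blast
      then have "- ((\<rho>2 - \<rho>1) / (8 * l) * I) \<le> 0"
        using mult_nonneg_nonneg[OF less_imp_le[OF pos]] by (simp only: neg_le_0_iff_le)
      moreover have "- f \<tau> x \<le> N \<tau>" if "\<tau> \<in> {0..T}" for \<tau> using leN[OF that, of x] by linarith
      ultimately show ?thesis using False Nx DERIV_minus[OF I(2)]
        by (intro exI[of _ "\<lambda>\<tau>. - f \<tau> x"]) auto
    qed
  qed
  fix t assume t: "t \<in> {0..T}"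
  have z: "0 \<in> {0..T}" using assms(4) by simp
  \<comment> \<open>An extended real has to be shown finite before it can serve as the bound of a supremum of
    reals.\<close>
  have NL: "ereal (N 0) \<le> Linf_norm f0"
  proof -
    have le: "ereal \<bar>f0 x\<bar> \<le> Linf_norm f0" for x
      using Linf_norm_le_iff[of f0] cont[OF z] init by blast
    then have "0 \<le> Linf_norm f0" by (meson abs_ge_zero ereal_less_eq(5) order_trans)
    moreover have "Linf_norm f0 < ereal l" using assms(3) by (simp add: Sobolev_strip_def)
    ultimately obtain C where "Linf_norm f0 = ereal C" by (cases "Linf_norm f0") auto
    then show ?thesis using Nle[OF z, of C] le init by simp
  qed
  show "Linf_norm (f t) \<le> Linf_norm f0"
    unfolding Linf_norm_le_iff[OF cont[OF t]]
  proof
    fix x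
    have "\<bar>f t x\<bar> \<le> N 0"
      using leN[OF t, of x] nonincreasing_if_touched_from_below[OF contN touch t] by linarith
    then show "ereal \<bar>f t x\<bar> \<le> Linf_norm f0" using NL by (meson ereal_less_eq(3) order_trans)
  qed
qed

end
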